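(* Let $A$ and $B$ be Archimedean semiprime $f$-algebras with point separating order duals and with weak order units $e_A$ and $e_B$ respectively, and let $T:A\to B$ be a weak Markov operator (with respect to $e_A$, $e_B$). If $B$ is order complete, then $T$ is an extreme point of the set of all weak Markov operators from $A$ to $B$ (with respect to $e_A$, $e_B$) if and only if $T$ is a lattice homomorphism.
   Context: A Riesz algebra (lattice-ordered algebra) is a real associative algebra $A$ that is also a Riesz space (vector lattice) such that $ab\ge 0$ whenever $a,b\ge 0$. It is an $f$-algebra if $a\wedge b=0$ implies $ac\wedge b=ca\wedge b=0$ for all $0\le c\in A$. An $f$-algebra is semiprime if $0$ is its only nilpotent element (for Archimedean $f$-algebras: $a^2=0$ implies $a=0$). The order dual of $A$ (the space of order bounded linear functionals on $A$) separates points if for every $0\neq a\in A$ there is an order bounded linear functional $\varphi$ on $A$ with $\varphi(a)\neq 0$. A weak order unit of $A$ is an element $0\le e\in A$ such that $|a|\wedge e=0$ implies $a=0$ for all $a\in A$. For fixed weak order units $e_A\in A$, $e_B\in B$, a weak Markov operator from $A$ to $B$ is a positive linear operator $T:A\to B$ with $T(e_A)=e_B$. Order complete (Dedekind complete) means that every nonempty subset that is bounded above has a supremum. A lattice homomorphism is a linear operator $T$ with $T(a\vee b)=Ta\vee Tb$ for all $a,b$. *)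

theory Defs
  imports
    "HOL-Analysis.Analysis"
    "HOL-Library.Function_Algebras"
    "HOL-Library.Lattice_Algebras"
begin

section \<open>Riesz algebras and f-algebras\<close>

text \<open>
  Algebras are associative and need not have a multiplicative unit. In the class
  \<open>lattice_ring\<close>, monotonicity of multiplication by nonnegative elements is equivalent to the
  positive cone being closed under products, and the absolute value is \<open>\<bar>a\<bar> = sup a (- a)\<close>.
\<close>

class riesz_algebra = real_algebra + ordered_real_vector + lattice_ring

class f_algebra = riesz_algebra +
  assumes inf_mult_right_eq_0: "inf a b = 0 \<Longrightarrow> 0 \<le> c \<Longrightarrow> inf (a * c) b = 0"
    and inf_mult_left_eq_0: "inf a b = 0 \<Longrightarrow> 0 \<le> c \<Longrightarrow> inf (c * a) b = 0"

class archimedean_riesz_space = ordered_real_vector + lattice +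
  assumes archimedean_eq_0: "0 \<le> x \<Longrightarrow> (\<And>n::nat. real n *\<^sub>R x \<le> y) \<Longrightarrow> x = 0"

text \<open>
  Without a unit the library's power operation is not available; \<open>((*) a ^^ n) a\<close> is the
  \<open>(n + 1)\<close>-fold product of \<open>a\<close> with itself.
\<close>

definition (in ring) nilpotent :: "'a \<Rightarrow> bool"
  where "nilpotent a \<longleftrightarrow> (\<exists>n. ((*) a ^^ n) a = 0)"

class semiprime_f_algebra = f_algebra +
  assumes nilpotent_imp_eq_0: "nilpotent a \<Longrightarrow> a = 0"

definition weak_order_unit :: "'a::lattice_ab_group_add_abs \<Rightarrow> bool"
  where "weak_order_unit e \<longleftrightarrow> 0 \<le> e \<and> (\<forall>a. inf \<bar>a\<bar> e = 0 \<longrightarrow> a = 0)"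


section \<open>Operators and functionals\<close>

definition order_bounded :: "('a::order \<Rightarrow> 'b::order) \<Rightarrow> bool"
  where "order_bounded f \<longleftrightarrow> (\<forall>x y. \<exists>u v. f ` {x..y} \<subseteq> {u..v})"

definition order_dual :: "('a::ordered_real_vector \<Rightarrow> real) set"
  where "order_dual = {\<phi>. linear \<phi> \<and> order_bounded \<phi>}"

definition separates_points :: "('a::zero \<Rightarrow> real) set \<Rightarrow> bool"
  where "separates_points F \<longleftrightarrow> (\<forall>a. a \<noteq> 0 \<longrightarrow> (\<exists>\<phi>\<in>F. \<phi> a \<noteq> 0))"

definition positive_operator ::
    "('a::ordered_real_vector \<Rightarrow> 'b::ordered_real_vector) \<Rightarrow> bool"
  where "positive_operator T \<longleftrightarrow> linear T \<and> (\<forall>a. 0 \<le> a \<longrightarrow> 0 \<le> T a)"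

definition weak_markov_operators ::
    "'a \<Rightarrow> 'b \<Rightarrow> ('a::ordered_real_vector \<Rightarrow> 'b::ordered_real_vector) set"
  where "weak_markov_operators e\<^sub>A e\<^sub>B = {T. positive_operator T \<and> T e\<^sub>A = e\<^sub>B}"

definition lattice_homomorphism ::
    "('a::{real_vector, lattice} \<Rightarrow> 'b::{real_vector, lattice}) \<Rightarrow> bool"
  where "lattice_homomorphism T \<longleftrightarrow> linear T \<and> (\<forall>a b. T (sup a b) = sup (T a) (T b))"


section \<open>Pointwise vector space structure on functions\<close>

text \<open>
  This makes \<^const>\<open>extreme_point_of\<close> applicable to sets of operators.
\<close>

instantiation "fun" :: (type, real_vector) real_vector
begin

definition scaleR_fun :: "real \<Rightarrow> ('a \<Rightarrow> 'b) \<Rightarrow> 'a \<Rightarrow> 'b"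
  where "scaleR_fun r f = (\<lambda>x. r *\<^sub>R f x)"

instance
  by standard (simp_all add: scaleR_fun_def fun_eq_iff scaleR_add_right scaleR_add_left)

end

end

theory Submission
  imports Defs
begin

text \<open>
  Everything rests on one fact about a weak order unit \<open>e\<close> of an Archimedean vector lattice: the
  only \<open>u \<ge> 0\<close> with \<open>u \<le> \<bar>y - l e\<bar>\<close> for all real \<open>l\<close> is \<open>u = 0\<close>
  (\<open>weak_order_unit_distance_eq_0\<close>). If the elements are thought of as functions and \<open>e\<close> as
  strictly positive, then at each point the choice \<open>l = y / e\<close> makes the right-hand side vanish.
  The fact replaces such a representation in both directions of the theorem.

  Lattice homomorphisms are extreme: let \<open>T\<close> be one, lying strictly between weak Markov operators
  \<open>S\<close> and \<open>R\<close>. Then \<open>S \<le> c T\<close> for a constant \<open>c\<close>, so \<open>D = S - T\<close> satisfies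
  \<open>\<bar>D z\<bar> \<le> (c + 1) \<bar>T z\<bar>\<close>. Since \<open>D\<close> vanishes at \<open>e\<^sub>A\<close>, replacing \<open>z\<close> by \<open>z - l e\<^sub>A\<close> gives
  \<open>\<bar>D z\<bar> \<le> (c + 1) \<bar>T z - l e\<^sub>B\<bar>\<close> for all \<open>l\<close>, whence \<open>D z = 0\<close>.

  Extreme operators are lattice homomorphisms: let \<open>T\<close> be extreme and \<open>inf x y = 0\<close>. Order
  completeness of the codomain provides an operator \<open>0 \<le> S \<le> T\<close> with \<open>S x = T x\<close> and \<open>S y = 0\<close>
  (\<open>exists_operator_component\<close>). It also provides a linear \<open>P\<close> with \<open>0 \<le> P \<le> id\<close> and
  \<open>P e\<^sub>B = S e\<^sub>A\<close> (\<open>exists_operator_between_0_and_id\<close>), which is multiplication by the function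
  \<open>S e\<^sub>A / e\<^sub>B\<close>. The operator \<open>D = S - P \<circ> T\<close> vanishes at \<open>e\<^sub>A\<close>, and \<open>T + D\<close> and \<open>T - D\<close> are
  positive, so extremality forces \<open>S = P \<circ> T\<close>. Thus \<open>P\<close> fixes \<open>T x\<close> and annihilates \<open>T y\<close>.
  Because \<open>P\<close> and \<open>id - P\<close> are both positive, both annihilate \<open>inf (T x) (T y)\<close>, which is
  therefore \<open>0\<close>: \<open>T\<close> preserves disjointness.
\<close>

section \<open>Vector lattices\<close>

text \<open>
  Lattice-ordered groups are distributive lattices. For \<open>d \<in> {b, c}\<close> the excess
  \<open>d - inf a d = sup (d - a) 0\<close> is at most \<open>sup (sup b c - a) 0 = sup b c - inf a (sup b c)\<close>;
  taking the supremum over \<open>d\<close> yields the inequality.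
\<close>

lemma lattice_group_inf_sup_le:
  fixes a b c :: "'a::lattice_ab_group_add"
  shows "inf a (sup b c) \<le> sup (inf a b) (inf a c)"
proof -
  let ?x = "inf a (sup b c)" and ?s = "sup (inf a b) (inf a c)"
  have excess: "d - inf a d = sup (d - a) 0" for d
    by (simp add: diff_inf_eq_sup add_sup_distrib_left)
  have *: "d \<le> ?s + sup b c - ?x" if "d \<le> sup b c" "inf a d \<le> ?s" for d
  proof -
    have "d - inf a d = sup (d - a) 0" by (rule excess)
    also have "\<dots> \<le> sup (sup b c - a) 0"
      using that(1) by (meson diff_right_mono order_refl sup.mono)
    also have "\<dots> = sup b c - ?x" by (rule excess[symmetric])
    finally have "d \<le> inf a d + (sup b c - ?x)" by (metis add.commute diff_le_eq)
    also have "\<dots> \<le> ?s + (sup b c - ?x)" using that(2) by (rule add_right_mono)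
    finally show ?thesis by (simp add: algebra_simps)
  qed
  have "sup b c \<le> ?s + sup b c - ?x" by (intro sup_least *) auto
  then have "sup b c + ?x \<le> sup b c + ?s" unfolding le_diff_eq by (simp only: add.commute)
  then show ?thesis by (rule add_le_imp_le_left)
qed

text \<open>
  The lattice form of a case distinction: two alternatives known to bound \<open>u\<close> are combined by
  distributivity into four cases, in place of arguing at the points of a function space.
\<close>

lemma le_of_le_sup_sup:
  fixes u :: "'a::lattice_ab_group_add"
  assumes "u \<le> sup a b" "u \<le> sup c d"
    and "inf a c \<le> w" "inf a d \<le> w" "inf b c \<le> w" "inf b d \<le> w"
  shows "u \<le> w"
proof -
  have *: "inf v (sup c d) \<le> w" if "inf v c \<le> w" "inf v d \<le> w" for v
    using lattice_group_inf_sup_le[of v c d] that by (meson order_trans sup_least)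
  have "u \<le> inf (sup c d) (sup a b)" using assms by simp
  also have "\<dots> \<le> sup (inf (sup c d) a) (inf (sup c d) b)" by (rule lattice_group_inf_sup_le)
  also have "\<dots> \<le> w" using *[of a] *[of b] assms by (simp add: inf_commute)
  finally show ?thesis .
qed

lemma inf_add_le:
  fixes z w c :: "'a::lattice_ab_group_add"
  assumes "0 \<le> z" "0 \<le> w" "0 \<le> c"
  shows "inf (z + w) c \<le> inf z c + inf w c"
proof -
  let ?m = "inf (z + w) c"
  have 1: "?m \<le> z + w" and 2: "?m \<le> c" by auto
  have "?m - z \<le> w" using 1 by (simp add: algebra_simps)
  moreover have "?m - z \<le> c" using 2 assms(1) by (metis add_increasing diff_le_eq add.commute)
  moreover have "?m - c \<le> w" using 2 assms(2) by (metis add_increasing diff_le_eq add.commute)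
  moreover have "?m - c \<le> c" using 2 assms(3) by (metis add_increasing diff_le_eq add.commute)
  ultimately have "sup (?m - z) (?m - c) \<le> inf w c" by (intro sup_least inf_greatest)
  moreover have "sup (?m - z) (?m - c) = ?m - inf z c"
    unfolding diff_inf_eq_sup[of "?m"] add_sup_distrib_left by simp
  ultimately have "?m - inf z c \<le> inf w c" by simp
  then show ?thesis by (metis diff_le_eq add.commute)
qed

lemma scaleR_sup:
  fixes a b :: "'a::{ordered_real_vector, lattice}"
  assumes "0 < c"
  shows "c *\<^sub>R sup a b = sup (c *\<^sub>R a) (c *\<^sub>R b)"
proof (rule antisym)
  have "a \<le> sup (c *\<^sub>R a) (c *\<^sub>R b) /\<^sub>R c" "b \<le> sup (c *\<^sub>R a) (c *\<^sub>R b) /\<^sub>R c"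
    unfolding pos_le_divideR_eq[OF assms] by simp_all
  then show "c *\<^sub>R sup a b \<le> sup (c *\<^sub>R a) (c *\<^sub>R b)"
    unfolding pos_le_divideR_eq[OF assms, symmetric] by simp
  show "sup (c *\<^sub>R a) (c *\<^sub>R b) \<le> c *\<^sub>R sup a b"
    using assms by (intro sup_least scaleR_left_mono) auto
qed

lemma scaleR_inf:
  fixes a b :: "'a::{ordered_real_vector, lattice}"
  assumes "0 < c"
  shows "c *\<^sub>R inf a b = inf (c *\<^sub>R a) (c *\<^sub>R b)"
proof (rule antisym)
  have "inf (c *\<^sub>R a) (c *\<^sub>R b) /\<^sub>R c \<le> a" "inf (c *\<^sub>R a) (c *\<^sub>R b) /\<^sub>R c \<le> b"
    unfolding pos_divideR_le_eq[OF assms] by simp_all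
  then show "inf (c *\<^sub>R a) (c *\<^sub>R b) \<le> c *\<^sub>R inf a b"
    unfolding pos_divideR_le_eq[OF assms, symmetric] by simp
  show "c *\<^sub>R inf a b \<le> inf (c *\<^sub>R a) (c *\<^sub>R b)"
    using assms by (intro inf_greatest scaleR_left_mono) auto
qed

section \<open>Distances to the multiples of a weak order unit\<close>

text \<open>
  Where \<open>y\<close> exceeds \<open>k e\<close>, the left-hand side is at most \<open>k e \<le> y\<close>; elsewhere it is \<open>0\<close>. Hence the
  part of \<open>y\<close> above \<open>k e\<close>, cut off at \<open>e\<close>, is at most \<open>y / k\<close>. This quantifies that
  an element cannot exceed all multiples of \<open>e\<close>.
\<close>

lemma truncation_times_le:
  fixes y e :: "'a::{ordered_real_vector, lattice_ab_group_add_abs}"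
  assumes "0 \<le> y" "0 \<le> e"
  shows "real k *\<^sub>R inf (sup (y - real k *\<^sub>R e) 0) e \<le> y"
proof (cases "k = 0")
  case False
  define r where "r = real k"
  have r: "0 < r" using False by (simp add: r_def)
  let ?m = "r *\<^sub>R inf (sup (y - r *\<^sub>R e) 0) e"
  have eq: "?m = inf (sup (r *\<^sub>R (y - r *\<^sub>R e)) 0) (r *\<^sub>R e)"
    using r by (simp add: scaleR_inf scaleR_sup)
  have b: "inf (r *\<^sub>R e) (r *\<^sub>R (y - r *\<^sub>R e)) \<le> y" (is "?n \<le> y")
  proof -
    \<comment> \<open>The infimum lies below the convex combination with weights \<open>1 / (1 + r)\<close> and \<open>r / (1 + r)\<close>,
      which is \<open>r / (1 + r)\<close> times \<open>y\<close>.\<close>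
    have n1: "?n \<le> r *\<^sub>R (y - r *\<^sub>R e)" and n2: "?n \<le> r *\<^sub>R e" by auto
    have "(1 + r) *\<^sub>R ?n = ?n + r *\<^sub>R ?n" by (simp add: scaleR_add_left)
    also have "\<dots> \<le> r *\<^sub>R (y - r *\<^sub>R e) + r *\<^sub>R (r *\<^sub>R e)"
      using n1 n2 r by (intro add_mono scaleR_left_mono) auto
    also have "\<dots> = r *\<^sub>R y" by (simp add: scaleR_diff_right)
    also have "\<dots> \<le> (1 + r) *\<^sub>R y" using assms(1) by (simp add: scaleR_right_mono)
    finally have "(1 + r) *\<^sub>R ?n \<le> (1 + r) *\<^sub>R y" .
    then have "?n \<le> ((1 + r) *\<^sub>R y) /\<^sub>R (1 + r)"
      using r by (subst pos_le_divideR_eq) auto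
    then show ?thesis using r by simp
  qed
  have "?m \<le> sup ?n (inf (r *\<^sub>R e) 0)"
    unfolding eq by (subst inf_commute) (rule lattice_group_inf_sup_le)
  also have "\<dots> \<le> y" using b assms by (auto intro: le_infI2)
  finally show ?thesis by (simp add: r_def)
qed (use assms in simp)

text \<open>
  It is enough that \<open>u \<le> d e\<close> for every \<open>d > 0\<close>. Consider the excess \<open>v\<close> of \<open>u\<close> over \<open>d e\<close>
  and walk through the multiples \<open>k d e\<close>. Where \<open>u\<close> exceeds \<open>d e\<close>, the element \<open>y\<close> keeps a
  distance greater than \<open>d e\<close> from each of them, so that it cannot pass from above \<open>k d e\<close> to
  below \<open>(k + 1) d e\<close>. Starting above \<open>0\<close>, it lies above all of them there, which is possible
  only if \<open>v = 0\<close>.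
\<close>

lemma weak_order_unit_distance_eq_0_pos:
  fixes e y u :: "'a::{ordered_real_vector, lattice_ab_group_add_abs, archimedean_riesz_space}"
  assumes e: "weak_order_unit e" and "0 \<le> u" "0 \<le> y"
    and u: "\<And>l. 0 \<le> l \<Longrightarrow> u \<le> \<bar>y - l *\<^sub>R e\<bar>"
  shows "u = 0"
proof -
  have e0: "0 \<le> e" using e by (simp add: weak_order_unit_def)
  have le: "u \<le> d *\<^sub>R e" if d: "0 < d" for d
  proof -
    define v where "v = sup (u - d *\<^sub>R e) 0"
    have de: "0 \<le> d *\<^sub>R e" using d e0 by (simp add: scaleR_nonneg_nonneg)
    have v_le: "v \<le> sup (y - (real k * d) *\<^sub>R e) 0" for k
    proof (induction k)
      case 0
      have "u - d *\<^sub>R e \<le> y" using u[of 0] de \<open>0 \<le> y\<close> by (simp add: add_increasing2 diff_le_eq)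
      then show ?case by (simp add: v_def le_supI1)
    next
      case (Suc k)
      define z where "z = y - (real (Suc k) * d) *\<^sub>R e"
      have IH: "u - d *\<^sub>R e \<le> sup (z + d *\<^sub>R e) 0"
        using Suc.IH by (simp add: v_def z_def algebra_simps)
      have "u \<le> sup z (- z)"
        using u[of "real (Suc k) * d"] d by (simp add: z_def abs_lattice)
      then have "u - d *\<^sub>R e \<le> sup z (- z) - d *\<^sub>R e" by (rule diff_right_mono)
      also have "\<dots> = sup (z - d *\<^sub>R e) (- (z + d *\<^sub>R e))"
        using add_sup_distrib_right[of z "- z" "- (d *\<^sub>R e)"] by simp
      finally have B: "u - d *\<^sub>R e \<le> sup (z - d *\<^sub>R e) (- (z + d *\<^sub>R e))" .
      have zz: "z - d *\<^sub>R e \<le> sup z 0" using de by (intro le_supI1) simp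
      have "inf (- (z + d *\<^sub>R e)) (z + d *\<^sub>R e) \<le> 0"
        by (metis abs_ge_zero abs_lattice inf_commute neg_sup_eq_inf neg_le_0_iff_le minus_minus)
      then have "inf (- (z + d *\<^sub>R e)) (z + d *\<^sub>R e) \<le> sup z 0" by (rule le_supI2)
      then have "u - d *\<^sub>R e \<le> sup z 0"
        by (intro le_of_le_sup_sup[OF B IH]) (use zz in \<open>auto intro: le_infI1 le_infI2\<close>)
      then show ?case by (simp add: v_def z_def)
    qed
    have "inf v (d *\<^sub>R e) = 0"
    proof (rule archimedean_eq_0)
      show "0 \<le> inf v (d *\<^sub>R e)" using de by (simp add: v_def)
      show "real k *\<^sub>R inf v (d *\<^sub>R e) \<le> y" for k
      proof -
        have "inf v (d *\<^sub>R e) \<le> inf (sup (y - real k *\<^sub>R d *\<^sub>R e) 0) (d *\<^sub>R e)"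
          using v_le[of k] by (simp add: le_infI1)
        then show ?thesis
          using truncation_times_le[OF \<open>0 \<le> y\<close> de, of k]
          by (meson order_trans scaleR_left_mono of_nat_0_le_iff)
      qed
    qed
    then have "inf (inverse d *\<^sub>R v) e = 0"
      using d scaleR_inf[of "inverse d" v "d *\<^sub>R e"] by simp
    moreover have "\<bar>inverse d *\<^sub>R v\<bar> = inverse d *\<^sub>R v"
      using d by (auto simp: v_def intro!: abs_of_nonneg scaleR_nonneg_nonneg)
    ultimately have "inverse d *\<^sub>R v = 0" using e by (metis weak_order_unit_def)
    then have "v = 0" using d by simp
    then show ?thesis by (metis diff_le_0_iff_le sup_ge1 v_def)
  qed
  show ?thesis
  proof (rule archimedean_eq_0)
    show "real n *\<^sub>R u \<le> e" for n
    proof (cases "n = 0")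
      case False
      then show ?thesis using le[of "inverse (real n)"] by (simp add: pos_le_divideR_eq)
    qed (simp add: e0)
  qed fact
qed

text \<open>
  The case of \<open>y \<ge> 0\<close> applies to \<open>\<bar>y\<bar>\<close>, because \<open>\<bar>\<bar>y\<bar> - l e\<bar>\<close> is
  at every point one of \<open>\<bar>y - l e\<bar>\<close> and \<open>\<bar>y + l e\<bar>\<close>.
\<close>

lemma weak_order_unit_distance_eq_0:
  fixes e y u :: "'a::{ordered_real_vector, lattice_ab_group_add_abs, archimedean_riesz_space}"
  assumes e: "weak_order_unit e" and "0 \<le> u" and u: "\<And>l. u \<le> \<bar>y - l *\<^sub>R e\<bar>"
  shows "u = 0"
proof (rule weak_order_unit_distance_eq_0_pos[OF e \<open>0 \<le> u\<close> abs_ge_zero])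
  fix l :: real
  define d where "d = l *\<^sub>R e"
  let ?w = "\<bar>\<bar>y\<bar> - d\<bar>"
  have 1: "u \<le> sup (y - d) (d - y)"
    using u[of l] by (simp add: d_def abs_lattice)
  have 2: "u \<le> sup (y + d) (- y - d)"
    using u[of "- l"] by (simp add: d_def abs_lattice)
  have 3: "y - d \<le> ?w" "- y - d \<le> ?w"
    by (meson abs_ge_self abs_ge_minus_self diff_right_mono order_trans)+
  have "inf (d - y) (y + d) = - (\<bar>y\<bar> - d)"
    using add_inf_distrib_right[of "- y" y d]
    by (simp add: abs_lattice neg_sup_eq_inf inf_commute add.commute)
  then have 4: "inf (d - y) (y + d) \<le> ?w" by (metis abs_ge_minus_self)
  show "u \<le> ?w" using 1 2 by (rule le_of_le_sup_sup) (use 3 4 in \<open>auto intro: le_infI1 le_infI2\<close>)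
qed

section \<open>Positive operators\<close>

text \<open>
  Kantorovich's extension: an additive map on the positive cone extends through differences of
  positive elements. Applying \<open>scale\<close> also to \<open>1 / c\<close> turns its inequality into an equation.
\<close>

lemma linear_extension_from_cone:
  fixes F :: "'a::{ordered_real_vector, lattice_ab_group_add_abs} \<Rightarrow> 'b::ordered_real_vector"
  assumes add: "\<And>z w. 0 \<le> z \<Longrightarrow> 0 \<le> w \<Longrightarrow> F (z + w) = F z + F w"
    and scale: "\<And>c z. 0 < c \<Longrightarrow> 0 \<le> z \<Longrightarrow> F (c *\<^sub>R z) \<le> c *\<^sub>R F z"
  obtains S where "linear S" "\<And>z. 0 \<le> z \<Longrightarrow> S z = F z"
proof
  define S where "S z = F (pprt z) - F (- nprt z)" for z
  \<comment> \<open>\<open>S\<close> may be computed from any decomposition into positive elements.\<close>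
  have S_diff: "S (a - b) = F a - F b" if "0 \<le> a" "0 \<le> b" for a b
  proof -
    have "a + - nprt (a - b) = b + pprt (a - b)"
      using prts[of "a - b"] by (simp add: algebra_simps)
    then have "F (a + - nprt (a - b)) = F (b + pprt (a - b))" by (rule arg_cong)
    moreover have "F (a + - nprt (a - b)) = F a + F (- nprt (a - b))" by (rule add) (use that in auto)
    moreover have "F (b + pprt (a - b)) = F b + F (pprt (a - b))" by (rule add) (use that in auto)
    ultimately show ?thesis by (simp add: S_def algebra_simps)
  qed
  have F0: "F 0 = 0" using add[of 0 0] by simp
  show "S z = F z" if "0 \<le> z" for z using S_diff[of z 0] that F0 by simp
  have hom: "F (c *\<^sub>R z) = c *\<^sub>R F z" if "0 < c" "0 \<le> z" for c z
  proof (rule antisym)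
    have "F z \<le> F (c *\<^sub>R z) /\<^sub>R c"
      using scale[of "inverse c" "c *\<^sub>R z"] that by (simp add: scaleR_nonneg_nonneg)
    then show "c *\<^sub>R F z \<le> F (c *\<^sub>R z)" unfolding pos_le_divideR_eq[OF that(1)] .
  qed (use scale that in blast)
  have z_eq: "z = pprt z - - nprt z" for z :: 'a using prts[of z] by simp
  have S_add: "S (z + w) = S z + S w" for z w
  proof -
    have "z + w = (pprt z + pprt w) - (- nprt z + - nprt w)"
      using arg_cong2[OF prts[of z] prts[of w], of "(+)"] by (simp add: algebra_simps)
    then have "S (z + w) = S ((pprt z + pprt w) - (- nprt z + - nprt w))" by (rule arg_cong)
    also have "\<dots> = F (pprt z + pprt w) - F (- nprt z + - nprt w)"
      by (intro S_diff add_nonneg_nonneg) simp_all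
    also have "\<dots> = S z + S w"
      using add[of "pprt z" "pprt w"] add[of "- nprt z" "- nprt w"] by (simp add: S_def)
    finally show ?thesis .
  qed
  have S_pos: "S (c *\<^sub>R z) = c *\<^sub>R S z" if "0 < c" for c z
  proof -
    have "c *\<^sub>R z = c *\<^sub>R pprt z - c *\<^sub>R (- nprt z)"
      by (metis z_eq scaleR_diff_right)
    then have "S (c *\<^sub>R z) = F (c *\<^sub>R pprt z) - F (c *\<^sub>R (- nprt z))"
      using S_diff[of "c *\<^sub>R pprt z" "c *\<^sub>R (- nprt z)"] that
      by (simp add: scaleR_nonneg_nonneg scaleR_nonneg_nonpos)
    also have "\<dots> = c *\<^sub>R S z"
      using hom[OF that, of "pprt z"] hom[OF that, of "- nprt z"]
      by (simp add: S_def scaleR_diff_right)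
    finally show ?thesis .
  qed
  have S0: "S 0 = 0" using S_add[of 0 0] by simp
  have S_neg: "S (- z) = - S z" for z using S_add[of z "- z"] S0 by (simp add: eq_neg_iff_add_eq_0 add.commute)
  show "linear S"
  proof (rule linearI)
    show "S (c *\<^sub>R z) = c *\<^sub>R S z" for c z
    proof (cases c "0::real" rule: linorder_cases)
      case less
      then show ?thesis using S_pos[of "- c" "- z"] by (simp add: S_neg)
    qed (simp_all add: S0 S_pos)
  qed (rule S_add)
qed

text \<open>
  For functions, \<open>P\<close> is multiplication by \<open>r = p / e\<close>, which has values in \<open>[0, 1]\<close>. Each \<open>l\<close>
  gives the upper bound \<open>r z \<le> l p + sup (z - l e) 0\<close>, with equality where \<open>z = l e\<close>, so \<open>P z\<close> is
  the infimum of these bounds over \<open>l\<close>. This infimum \<open>q\<close> is the sublinear function by which the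
  Hahn-Banach theorem would control the extensions of \<open>l e \<mapsto> l p\<close>. Here it is linear already:
  \<open>q z + q (- z)\<close> is at most \<open>\<bar>z - l e\<bar>\<close> for every \<open>l\<close>, hence \<open>0\<close>.
\<close>

lemma exists_operator_between_0_and_id:
  fixes e p :: "'a::{ordered_real_vector, lattice_ab_group_add_abs, archimedean_riesz_space,
    conditionally_complete_lattice}"
  assumes e: "weak_order_unit e" and "0 \<le> p" "p \<le> e"
  obtains P :: "'a \<Rightarrow> 'a" where "linear P" "\<And>z. 0 \<le> z \<Longrightarrow> 0 \<le> P z \<and> P z \<le> z" "P e = p"
proof -
  have e0: "0 \<le> e" using e by (simp add: weak_order_unit_def)
  define g where "g l z = l *\<^sub>R p + sup (z - l *\<^sub>R e) 0" for l z
  define q where "q z = (INF l. g l z)" for z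
  have g_add: "g (l + m) (z + w) \<le> g l z + g m w" for l m z w
  proof -
    have "z + w - (l + m) *\<^sub>R e = (z - l *\<^sub>R e) + (w - m *\<^sub>R e)"
      by (simp add: algebra_simps scaleR_add_left)
    also have "\<dots> \<le> sup (z - l *\<^sub>R e) 0 + sup (w - m *\<^sub>R e) 0" by (intro add_mono) auto
    finally have "sup (z + w - (l + m) *\<^sub>R e) 0 \<le> sup (z - l *\<^sub>R e) 0 + sup (w - m *\<^sub>R e) 0"
      by (intro sup_least add_nonneg_nonneg) auto
    then show ?thesis by (simp add: g_def scaleR_add_left add_mono add_ac)
  qed
  have g_nonneg: "0 \<le> g l z" if "0 \<le> z" for l z
  proof (cases "0 \<le> l")
    case False
    have "(- l) *\<^sub>R p \<le> (- l) *\<^sub>R e" using False \<open>p \<le> e\<close> by (intro scaleR_left_mono) auto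
    then have "0 \<le> l *\<^sub>R p + (0 - l *\<^sub>R e)" by simp
    also have "\<dots> \<le> g l z" unfolding g_def
      using that by (intro add_left_mono le_supI1 diff_right_mono)
    finally show ?thesis .
  qed (use \<open>0 \<le> p\<close> in \<open>simp add: g_def scaleR_nonneg_nonneg add_nonneg_nonneg\<close>)
  \<comment> \<open>Subadditivity against the fixed element \<open>g 0 (- z)\<close> bounds the family from below.\<close>
  have bdd: "bdd_below (range (\<lambda>l. g l z))" for z
  proof
    fix x assume "x \<in> range (\<lambda>l. g l z)"
    then obtain l where x: "x = g l z" by blast
    have "0 \<le> g (l + 0) (z + - z)" by (rule g_nonneg) simp
    also have "\<dots> \<le> g l z + g 0 (- z)" by (rule g_add)
    finally show "- g 0 (- z) \<le> x" unfolding x by (metis diff_0 diff_le_eq)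
  qed
  have q_le: "q z \<le> g l z" for l z unfolding q_def by (rule cINF_lower[OF bdd]) simp
  have le_q: "x \<le> q z" if "\<And>l. x \<le> g l z" for x z
    unfolding q_def by (rule cINF_greatest) (use that in auto)
  have q_sub: "q (z + w) \<le> q z + q w" for z w
  proof -
    have "q (z + w) - g m w \<le> q z" for m
    proof (rule le_q)
      show "q (z + w) - g m w \<le> g l z" for l
        using order_trans[OF q_le[of "z + w" "l + m"] g_add] by (simp add: algebra_simps)
    qed
    then have "q (z + w) - q z \<le> q w" by (intro le_q) (simp add: algebra_simps)
    then show ?thesis by (simp add: algebra_simps)
  qed
  have q_nonneg: "0 \<le> q z" if "0 \<le> z" for z by (rule le_q) (rule g_nonneg[OF that])
  have q_neg: "q z + q (- z) = 0" for z
  proof (rule weak_order_unit_distance_eq_0[OF e])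
    show "0 \<le> q z + q (- z)"
      using q_nonneg[of "z + - z"] q_sub[of z "- z"] by (simp del: add.right_inverse)
    show "q z + q (- z) \<le> \<bar>z - l *\<^sub>R e\<bar>" for l
    proof -
      have "q z + q (- z) \<le> g l z + g (- l) (- z)" by (intro add_mono q_le)
      also have "\<dots> = pprt (z - l *\<^sub>R e) + pprt (- (z - l *\<^sub>R e))"
        by (simp add: g_def pprt_def)
      also have "\<dots> = \<bar>z - l *\<^sub>R e\<bar>"
        by (simp add: abs_prts pprt_neg del: minus_diff_eq)
      finally show ?thesis .
    qed
  qed
  have q_add: "q (z + w) = q z + q w" for z w
  proof (rule antisym[OF q_sub])
    have "q z + q w \<le> q (z + w) + q (- w) + q w"
      using q_sub[of "z + w" "- w"] by (intro add_right_mono) simp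
    also have "\<dots> = q (z + w)" using q_neg[of w] by (simp add: add_ac)
    finally show "q z + q w \<le> q (z + w)" .
  qed
  have q_scale: "q (c *\<^sub>R z) \<le> c *\<^sub>R q z" if c: "0 < c" for c z
  proof -
    have "q (c *\<^sub>R z) /\<^sub>R c \<le> g l z" for l
    proof -
      have "q (c *\<^sub>R z) \<le> g (c * l) (c *\<^sub>R z)" by (rule q_le)
      also have "\<dots> = c *\<^sub>R g l z"
        using scaleR_sup[OF c, of "z - l *\<^sub>R e" 0]
        by (simp add: g_def scaleR_add_right scaleR_diff_right)
      finally show ?thesis unfolding pos_divideR_le_eq[OF c] .
    qed
    then have "q (c *\<^sub>R z) /\<^sub>R c \<le> q z" by (rule le_q)
    then show ?thesis unfolding pos_divideR_le_eq[OF c] .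
  qed
  obtain P where P: "linear P" "\<And>z. 0 \<le> z \<Longrightarrow> P z = q z"
    using linear_extension_from_cone[of q] q_add q_scale by metis
  show thesis
  proof
    show "linear P" by fact
    show "0 \<le> P z \<and> P z \<le> z" if "0 \<le> z" for z
      using q_nonneg[OF that] q_le[of z 0] that P(2)[OF that] by (simp add: g_def sup_absorb1)
    \<comment> \<open>The bounds with \<open>l = 1\<close> at \<open>e\<close> and \<open>l = - 1\<close> at \<open>- e\<close> enclose \<open>q e\<close>.\<close>
    have "q e \<le> p" using q_le[of e 1] by (simp add: g_def)
    moreover have "q (- e) \<le> - p" using q_le[of "- e" "- 1"] by (simp add: g_def)
    then have "p \<le> q e" using q_neg[of e] by (metis add.commute eq_neg_iff_add_eq_0 neg_le_iff_le)
    ultimately show "P e = p" using P(2)[OF e0] by simp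
  qed
qed

lemma positive_operator_mono: "positive_operator T \<Longrightarrow> x \<le> y \<Longrightarrow> T x \<le> T y"
  unfolding positive_operator_def by (metis diff_ge_0_iff_ge linear_diff)

text \<open>
  On the positive cone, \<open>S z\<close> is the supremum of \<open>T (inf z (l x))\<close> over \<open>l \<ge> 0\<close>: the part of
  \<open>T z\<close> that \<open>T\<close> takes from the ideal generated by \<open>x\<close>. The truncations \<open>inf z (l x)\<close>
  replace a projection of \<open>z\<close>, which may not exist in the domain.
  The supremum is additive because \<open>inf z (l x) + inf w (m x) \<le> inf (z + w) ((l + m) x)\<close>, and
  conversely \<open>inf (z + w) (l x) \<le> inf z (l x) + inf w (l x)\<close>.
\<close>

lemma exists_operator_component:
  fixes T :: "'a::{ordered_real_vector, lattice_ab_group_add_abs} \<Rightarrow>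
    'b::{ordered_real_vector, lattice_ab_group_add_abs, conditionally_complete_lattice}"
  assumes T: "positive_operator T" and x: "0 \<le> x"
  obtains S where "linear S" "\<And>z. 0 \<le> z \<Longrightarrow> 0 \<le> S z \<and> S z \<le> T z" "S x = T x"
    "\<And>y. inf x y = 0 \<Longrightarrow> S y = 0"
proof -
  have linT: "linear T" using T by (simp add: positive_operator_def)
  note mono = positive_operator_mono[OF T]
  define t where "t l z = T (inf z (l *\<^sub>R x))" for l z
  define F where "F z = (SUP l\<in>{0..}. t l z)" for z
  have lx: "0 \<le> l *\<^sub>R x" if "0 \<le> l" for l using x that by (simp add: scaleR_nonneg_nonneg)
  have t_le: "t l z \<le> T z" for l z unfolding t_def by (rule mono) simp
  have le_F: "t l z \<le> F z" if "0 \<le> l" for l z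
    unfolding F_def using that t_le by (intro cSUP_upper bdd_aboveI2) auto
  have F_le: "F z \<le> u" if "\<And>l. 0 \<le> l \<Longrightarrow> t l z \<le> u" for z u
    unfolding F_def using that by (intro cSUP_least) auto
  have F_add: "F (z + w) = F z + F w" if "0 \<le> z" "0 \<le> w" for z w
  proof (rule antisym)
    show "F (z + w) \<le> F z + F w"
    proof (rule F_le)
      fix l :: real assume l: "0 \<le> l"
      have "t l (z + w) \<le> T (inf z (l *\<^sub>R x) + inf w (l *\<^sub>R x))"
        unfolding t_def using inf_add_le[OF that lx[OF l]] by (rule mono)
      also have "\<dots> = t l z + t l w" by (simp add: t_def linear_add[OF linT])
      also have "\<dots> \<le> F z + F w" using l by (intro add_mono le_F)
      finally show "t l (z + w) \<le> F z + F w" .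
    qed
    have lm: "t l z + t m w \<le> F (z + w)" if "0 \<le> l" "0 \<le> m" for l m
    proof -
      have "t l z + t m w = T (inf z (l *\<^sub>R x) + inf w (m *\<^sub>R x))"
        by (simp add: t_def linear_add[OF linT])
      also have "\<dots> \<le> t (l + m) (z + w)"
        unfolding t_def scaleR_add_left by (intro mono inf_greatest add_mono) auto
      also have "\<dots> \<le> F (z + w)" using that by (intro le_F) auto
      finally show ?thesis .
    qed
    have "F w \<le> F (z + w) - t l z" if "0 \<le> l" for l
      by (rule F_le) (use lm[OF that] in \<open>simp add: le_diff_eq add.commute\<close>)
    then have "F z \<le> F (z + w) - F w" by (intro F_le) (simp add: algebra_simps)
    then show "F z + F w \<le> F (z + w)" by (simp add: algebra_simps)
  qed
  have F_scale: "F (c *\<^sub>R z) \<le> c *\<^sub>R F z" if c: "0 < c" for c z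
  proof (rule F_le)
    fix l :: real assume l: "0 \<le> l"
    have "inf (c *\<^sub>R z) (l *\<^sub>R x) = c *\<^sub>R inf z ((l / c) *\<^sub>R x)"
      using c by (simp add: scaleR_inf)
    then have "t l (c *\<^sub>R z) = c *\<^sub>R t (l / c) z" by (simp add: t_def linear_scale[OF linT])
    also have "\<dots> \<le> c *\<^sub>R F z" using c l by (intro scaleR_left_mono le_F) auto
    finally show "t l (c *\<^sub>R z) \<le> c *\<^sub>R F z" .
  qed
  obtain S where S: "linear S" "\<And>z. 0 \<le> z \<Longrightarrow> S z = F z"
    using linear_extension_from_cone[of F] F_add F_scale by metis
  show thesis
  proof
    show "linear S" by fact
    show "0 \<le> S z \<and> S z \<le> T z" if "0 \<le> z" for z
    proof
      show "S z \<le> T z" unfolding S(2)[OF that] by (rule F_le) (rule t_le)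
      have "t 0 z = 0" using that by (simp add: t_def inf_absorb2 linear_0[OF linT])
      then show "0 \<le> S z" unfolding S(2)[OF that] using le_F[of 0 z] by simp
    qed
    have "S x \<le> T x" unfolding S(2)[OF x] by (rule F_le) (rule t_le)
    moreover have "T x \<le> S x" unfolding S(2)[OF x] using le_F[of 1 x] by (simp add: t_def)
    ultimately show "S x = T x" by simp
    show "S y = 0" if xy: "inf x y = 0" for y
    proof -
      have y: "0 \<le> y" using xy by (metis inf_le2)
      have "t l y = 0" if l: "0 \<le> l" for l
      proof -
        define m where "m = max 1 l"
        have m: "1 \<le> m" "l \<le> m" by (auto simp: m_def)
        have "y = 1 *\<^sub>R y" by simp
        also have "1 *\<^sub>R y \<le> m *\<^sub>R y" using m y by (intro scaleR_right_mono)
        finally have "inf y (l *\<^sub>R x) \<le> inf (m *\<^sub>R y) (m *\<^sub>R x)"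
          using m x by (intro inf_mono scaleR_right_mono)
        also have "\<dots> = m *\<^sub>R inf y x" using m by (simp add: scaleR_inf)
        also have "\<dots> = 0" using xy by (simp add: inf_commute)
        finally have "inf y (l *\<^sub>R x) = 0" using y lx[OF l] by (intro antisym) auto
        then show ?thesis by (simp add: t_def linear_0[OF linT])
      qed
      then show ?thesis unfolding S(2)[OF y] F_def by simp
    qed
  qed
qed

text \<open>
  Subtracting \<open>inf a b\<close> from \<open>a\<close> and \<open>b\<close> makes them disjoint, and \<open>sup a b = a + b - inf a b\<close>
  reduces suprema to infima.
\<close>

lemma lattice_homomorphism_if_preserves_disjointness:
  fixes T :: "'a::{ordered_real_vector, lattice_ab_group_add_abs} \<Rightarrow>
    'b::{ordered_real_vector, lattice_ab_group_add_abs}"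
  assumes T: "linear T" and disj: "\<And>x y. inf x y = 0 \<Longrightarrow> inf (T x) (T y) = 0"
  shows "lattice_homomorphism T"
proof -
  have "T (sup a b) = sup (T a) (T b)" for a b
  proof -
    define m where "m = inf a b"
    have "inf (a - m) (b - m) = 0"
      using add_inf_distrib_right[of a b "- m"] by (simp add: m_def[symmetric])
    then have "inf (T a - T m) (T b - T m) = 0"
      using disj by (metis linear_diff[OF T])
    then have inf: "inf (T a) (T b) = T (inf a b)"
      using add_inf_distrib_right[of "T a" "T b" "- T m"] by (simp add: m_def[symmetric])
    have "sup a b = a + b - inf a b" by (metis add_diff_cancel_right' add_eq_inf_sup)
    then have "T (sup a b) = T a + T b - inf (T a) (T b)"
      by (simp only: linear_add[OF T] linear_diff[OF T] inf)
    also have "\<dots> = sup (T a) (T b)" by (metis add_diff_cancel_right' add_eq_inf_sup)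
    finally show ?thesis .
  qed
  then show ?thesis using T by (simp add: lattice_homomorphism_def)
qed

text \<open>
  The difference \<open>S - T\<close> is bounded by a multiple of \<open>\<bar>T w\<bar>\<close> at every \<open>w\<close> and does not see
  multiples of \<open>e\<close>. Taking \<open>w = z - l e\<close>, its modulus at \<open>z\<close> is bounded by
  a multiple of the distance from \<open>T z\<close> to each \<open>l T e\<close>.
\<close>

lemma lattice_homomorphism_eq_if_dominates:
  fixes T S :: "'a::{ordered_real_vector, lattice_ab_group_add_abs} \<Rightarrow>
    'b::{ordered_real_vector, lattice_ab_group_add_abs, archimedean_riesz_space}"
  assumes T: "lattice_homomorphism T" and S: "positive_operator S" and c: "0 \<le> c"
    and dom: "\<And>z. 0 \<le> z \<Longrightarrow> S z \<le> c *\<^sub>R T z"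
    and eq: "S e = T e" and unit: "weak_order_unit (T e)"
  shows "S = T"
proof
  fix z
  have linT: "linear T" and linS: "linear S"
    using T S by (simp_all add: lattice_homomorphism_def positive_operator_def)
  have T_abs: "T \<bar>w\<bar> = \<bar>T w\<bar>" for w
    using T by (simp add: abs_lattice lattice_homomorphism_def linear_neg[OF linT])
  have bound: "\<bar>S w - T w\<bar> \<le> (c + 1) *\<^sub>R \<bar>T w\<bar>" for w
  proof -
    have "\<bar>S w\<bar> \<le> S \<bar>w\<bar>"
      using positive_operator_mono[OF S abs_ge_self, of w]
        positive_operator_mono[OF S abs_ge_minus_self, of w]
      by (intro abs_leI) (simp_all add: linear_neg[OF linS])
    also have "\<dots> \<le> c *\<^sub>R \<bar>T w\<bar>" using dom[of "\<bar>w\<bar>"] by (simp add: T_abs)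
    finally have "\<bar>S w\<bar> + \<bar>T w\<bar> \<le> (c + 1) *\<^sub>R \<bar>T w\<bar>" by (simp add: scaleR_add_left)
    then show ?thesis using abs_triangle_ineq4 order_trans by blast
  qed
  have "\<bar>S z - T z\<bar> /\<^sub>R (c + 1) = 0"
  proof (rule weak_order_unit_distance_eq_0[OF unit])
    show "0 \<le> \<bar>S z - T z\<bar> /\<^sub>R (c + 1)" using c by (simp add: scaleR_nonneg_nonneg)
    fix l
    have "S z - T z = S (z - l *\<^sub>R e) - T (z - l *\<^sub>R e)"
      by (simp add: linear_diff[OF linS] linear_diff[OF linT] linear_scale[OF linS]
          linear_scale[OF linT] eq)
    then have "\<bar>S z - T z\<bar> \<le> (c + 1) *\<^sub>R \<bar>T (z - l *\<^sub>R e)\<bar>" using bound by metis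
    moreover have "0 < c + 1" using c by simp
    ultimately have "\<bar>S z - T z\<bar> /\<^sub>R (c + 1) \<le> \<bar>T (z - l *\<^sub>R e)\<bar>"
      by (simp only: pos_divideR_le_eq)
    then show "\<bar>S z - T z\<bar> /\<^sub>R (c + 1) \<le> \<bar>T z - l *\<^sub>R T e\<bar>"
      by (simp add: linear_diff[OF linT] linear_scale[OF linT])
  qed
  then show "S z = T z" using c by simp
qed

section \<open>Extreme weak Markov operators\<close>

text \<open>
  Otherwise \<open>T\<close> would be the midpoint of the two distinct weak Markov operators \<open>T + D\<close>
  and \<open>T - D\<close>.
\<close>

lemma extreme_weak_markov_zero_perturbation:
  assumes ext: "T extreme_point_of weak_markov_operators e f"
    and D: "linear D" "D e = 0" and dom: "\<And>z. 0 \<le> z \<Longrightarrow> D z \<le> T z \<and> - D z \<le> T z"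
  shows "D z = 0"
proof (rule ccontr)
  assume "D z \<noteq> 0"
  have T: "linear T" "T e = f"
    using ext by (auto simp: extreme_point_of_def weak_markov_operators_def positive_operator_def)
  have "linear (\<lambda>z. T z + D z)" "linear (\<lambda>z. T z - D z)"
    using T(1) D(1) by (auto intro: linear_compose_add linear_compose_sub)
  moreover have "0 \<le> T z + D z" "0 \<le> T z - D z" if "0 \<le> z" for z
    using add_left_mono[OF dom[OF that, THEN conjunct2], of "D z"] dom[OF that]
    by (simp_all add: add.commute)
  ultimately have "(\<lambda>z. T z + D z) \<in> weak_markov_operators e f"
    "(\<lambda>z. T z - D z) \<in> weak_markov_operators e f"
    using D T by (simp_all add: weak_markov_operators_def positive_operator_def)
  moreover have "T \<in> open_segment (\<lambda>z. T z + D z) (\<lambda>z. T z - D z)"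
  proof -
    have "T w + D w \<noteq> T w - D w" if "D w \<noteq> 0" for w
    proof
      assume "T w + D w = T w - D w"
      then have "2 *\<^sub>R D w = 0" by (simp add: scaleR_2 algebra_simps eq_neg_iff_add_eq_0)
      then show False using that by simp
    qed
    then have "(\<lambda>z. T z + D z) \<noteq> (\<lambda>z. T z - D z)" using \<open>D z \<noteq> 0\<close> by meson
    moreover have "T = (1 - 1/2) *\<^sub>R (\<lambda>z. T z + D z) + (1/2) *\<^sub>R (\<lambda>z. T z - D z)"
      by (simp add: fun_eq_iff scaleR_fun_def scaleR_add_right scaleR_diff_right
          flip: scaleR_add_left)
    ultimately show ?thesis unfolding in_segment(2)
      by (intro conjI exI[of _ "1/2"]) auto
  qed
  ultimately show False using ext by (auto simp: extreme_point_of_def)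
qed

lemma extreme_weak_markov_imp_lattice_homomorphism:
  fixes T :: "'a::{ordered_real_vector, lattice_ab_group_add_abs} \<Rightarrow>
    'b::{ordered_real_vector, lattice_ab_group_add_abs, archimedean_riesz_space,
      conditionally_complete_lattice}"
  assumes ext: "T extreme_point_of weak_markov_operators e f"
    and e: "0 \<le> e" and f: "weak_order_unit f"
  shows "lattice_homomorphism T"
proof (rule lattice_homomorphism_if_preserves_disjointness)
  have T: "positive_operator T" "T e = f"
    using ext by (auto simp: extreme_point_of_def weak_markov_operators_def)
  then show linT: "linear T" by (simp add: positive_operator_def)
  fix x y :: 'a
  assume xy: "inf x y = 0"
  have x: "0 \<le> x" and y: "0 \<le> y" using xy by (metis inf_le1, metis inf_le2)
  obtain S where S: "linear S" "\<And>z. 0 \<le> z \<Longrightarrow> 0 \<le> S z \<and> S z \<le> T z" "S x = T x"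
    "\<And>w. inf x w = 0 \<Longrightarrow> S w = 0"
    using exists_operator_component[OF T(1) x] by blast
  have "0 \<le> S e" "S e \<le> f" using S(2)[OF e] T(2) by auto
  then obtain P where P: "linear P" "\<And>z. 0 \<le> z \<Longrightarrow> 0 \<le> P z \<and> P z \<le> z" "P f = S e"
    using exists_operator_between_0_and_id[OF f] by blast
  have T_nonneg: "0 \<le> T z" if "0 \<le> z" for z using T(1) that by (simp add: positive_operator_def)
  have S_eq: "S z = P (T z)" for z
  proof -
    have "S z - P (T z) = 0"
    proof (rule extreme_weak_markov_zero_perturbation[OF ext])
      show "linear (\<lambda>z. S z - P (T z))"
        using linear_compose_sub[OF S(1) linear_compose[OF linT P(1)]] by (simp add: o_def)
      show "S e - P (T e) = 0" using T(2) P(3) by simp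
      show "S z - P (T z) \<le> T z \<and> - (S z - P (T z)) \<le> T z" if "0 \<le> z" for z
      proof
        have "S z - P (T z) \<le> T z - 0"
          using S(2)[OF that] P(2)[OF T_nonneg[OF that]] by (intro diff_mono) auto
        then show "S z - P (T z) \<le> T z" by simp
        have "P (T z) - S z \<le> T z - 0"
          using S(2)[OF that] P(2)[OF T_nonneg[OF that]] by (intro diff_mono) auto
        then show "- (S z - P (T z)) \<le> T z" by simp
      qed
    qed
    then show ?thesis by simp
  qed
  have PTx: "P (T x) = T x" using S_eq[of x] S(3) by simp
  have PTy: "P (T y) = 0" using S_eq[of y] S(4)[OF xy] by simp
  define t where "t = inf (T x) (T y)"
  have t: "0 \<le> t" "t \<le> T x" "t \<le> T y" using T_nonneg[OF x] T_nonneg[OF y] by (auto simp: t_def)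
  have "P t \<le> 0"
    using P(2)[of "T y - t"] t PTy by (simp add: linear_diff[OF P(1)])
  moreover have "t \<le> P t"
    using P(2)[of "T x - t"] t PTx by (simp add: linear_diff[OF P(1)])
  ultimately have "t = 0" using t(1) by (meson antisym order_trans)
  then show "inf (T x) (T y) = 0" by (simp only: t_def)
qed

lemma lattice_homomorphism_imp_extreme_weak_markov:
  fixes T :: "'a::{ordered_real_vector, lattice_ab_group_add_abs} \<Rightarrow>
    'b::{ordered_real_vector, lattice_ab_group_add_abs, archimedean_riesz_space}"
  assumes hom: "lattice_homomorphism T" and T: "T \<in> weak_markov_operators e f"
    and f: "weak_order_unit f"
  shows "T extreme_point_of weak_markov_operators e f"
  unfolding extreme_point_of_def
proof (intro conjI ballI notI T)
  fix S R
  assume S: "S \<in> weak_markov_operators e f" and R: "R \<in> weak_markov_operators e f"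
    and seg: "T \<in> open_segment S R"
  obtain u where u: "0 < u" "u < 1" and T_eq: "T = (1 - u) *\<^sub>R S + u *\<^sub>R R"
    using seg unfolding in_segment(2) by blast
  have "S = T"
  proof (rule lattice_homomorphism_eq_if_dominates[OF hom])
    show "positive_operator S" using S by (simp add: weak_markov_operators_def)
    show "S e = T e" using S T by (simp add: weak_markov_operators_def)
    show "weak_order_unit (T e)" using T f by (simp add: weak_markov_operators_def)
    show "0 \<le> inverse (1 - u)" using u by simp
    show "S z \<le> T z /\<^sub>R (1 - u)" if "0 \<le> z" for z
    proof -
      have "0 \<le> R z" using R that by (simp add: weak_markov_operators_def positive_operator_def)
      then have "(1 - u) *\<^sub>R S z \<le> T z"
        using u by (simp add: T_eq scaleR_fun_def scaleR_nonneg_nonneg)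
      then show ?thesis using u pos_le_divideR_eq[of "1 - u" "S z" "T z"] by simp
    qed
  qed
  then show False using seg by (auto simp: open_segment_def)
qed

theorem theorem2:
  fixes T :: "'a::{semiprime_f_algebra, archimedean_riesz_space} \<Rightarrow>
      'b::{semiprime_f_algebra, archimedean_riesz_space, conditionally_complete_lattice}"
    and e\<^sub>A :: 'a and e\<^sub>B :: 'b
  assumes "separates_points (order_dual :: ('a \<Rightarrow> real) set)"
    and "separates_points (order_dual :: ('b \<Rightarrow> real) set)"
    and "weak_order_unit e\<^sub>A"
    and "weak_order_unit e\<^sub>B"
    and "T \<in> weak_markov_operators e\<^sub>A e\<^sub>B"
  shows "T extreme_point_of weak_markov_operators e\<^sub>A e\<^sub>B \<longleftrightarrow> lattice_homomorphism T"
proof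
  assume "T extreme_point_of weak_markov_operators e\<^sub>A e\<^sub>B"
  then show "lattice_homomorphism T"
    using assms(3,4) by (intro extreme_weak_markov_imp_lattice_homomorphism)
      (auto simp: weak_order_unit_def)
next
  assume "lattice_homomorphism T"
  then show "T extreme_point_of weak_markov_operators e\<^sub>A e\<^sub>B"
    using assms(4,5) by (intro lattice_homomorphism_imp_extreme_weak_markov)
qed

end
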